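(* Let $n\ge 4$ be an even integer. Then $$r_{\mathrm{odd}}(n,n/2+2;C_n)\ge 3.$$
   Context: All graphs are finite and simple; $v(G)$ is the number of vertices and $\delta(G)$ the minimum degree of $G$. An $r$-coloring of a graph $G$ is a map $\chi:E(G)\to[r]=\{1,\dots,r\}$ (not necessarily proper or surjective). $C_n$ is the cycle on $n$ vertices, so a copy of $C_n$ in an $n$-vertex graph is a Hamilton cycle. For graphs $G,H$, the odd-Ramsey number $r_{\mathrm{odd}}(G,H)$ is the minimum positive integer $r$ for which there is an $r$-coloring of $G$ such that in every (not necessarily induced) copy of $H$ in $G$ some color occurs on an odd number of edges of that copy. For even $n\ge4$ and an integer $d$, define $$r_{\mathrm{odd}}(n,d;C_n)=\min\{r_{\mathrm{odd}}(G,C_n): v(G)=n,\ \delta(G)\ge d\},$$ where the minimum over an empty family is $+\infty$ (this occurs here only for $n=4$, as no $4$-vertex graph has minimum degree at least $4$). *)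

theory Defs
  imports "HOL-Library.Extended_Nat" "HOL-Library.FuncSet"
begin

record 'a sgraph =
  verts :: "'a set"
  edges :: "'a set set"

definition simple_graph :: "'a sgraph \<Rightarrow> bool" where
  "simple_graph G \<longleftrightarrow> finite (verts G) \<and> (\<forall>e\<in>edges G. e \<subseteq> verts G \<and> card e = 2)"

definition degree :: "'a sgraph \<Rightarrow> 'a \<Rightarrow> nat" where
  "degree G v = card {e \<in> edges G. v \<in> e}"

(* Meaningful only for a nonempty finite vertex set. *)
definition min_degree :: "'a sgraph \<Rightarrow> nat" where
  "min_degree G = Min (degree G ` verts G)"

definition subgraph :: "'a sgraph \<Rightarrow> 'a sgraph \<Rightarrow> bool" where
  "subgraph K G \<longleftrightarrow> simple_graph K \<and> verts K \<subseteq> verts G \<and> edges K \<subseteq> edges G"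

definition isomorphic :: "'a sgraph \<Rightarrow> 'b sgraph \<Rightarrow> bool" where
  "isomorphic K H \<longleftrightarrow>
    (\<exists>f. bij_betw f (verts K) (verts H) \<and> edges H = (\<lambda>e. f ` e) ` edges K)"

definition copies :: "'b sgraph \<Rightarrow> 'a sgraph \<Rightarrow> 'a sgraph set" where
  "copies H G = {K. subgraph K G \<and> isomorphic K H}"

(* The cycle on n vertices, for n at least 3. *)
definition cycle_graph :: "nat \<Rightarrow> nat sgraph" where
  "cycle_graph n = \<lparr>verts = {0..<n}, edges = {{i, (i + 1) mod n} | i. i < n}\<rparr>"

definition edge_coloring :: "'a sgraph \<Rightarrow> nat \<Rightarrow> ('a set \<Rightarrow> nat) \<Rightarrow> bool" where
  "edge_coloring G r \<chi> \<longleftrightarrow> \<chi> \<in> edges G \<rightarrow> {1..r}"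

definition odd_ramsey_coloring ::
    "'a sgraph \<Rightarrow> 'b sgraph \<Rightarrow> nat \<Rightarrow> ('a set \<Rightarrow> nat) \<Rightarrow> bool" where
  "odd_ramsey_coloring G H r \<chi> \<longleftrightarrow> edge_coloring G r \<chi> \<and>
    (\<forall>K\<in>copies H G. \<exists>c\<in>{1..r}. odd (card {e \<in> edges K. \<chi> e = c}))"

(* Every nonempty set of extended naturals contains its infimum and the infimum of the
   empty set is infinity, so Inf is the minimum with the convention min {} = infinity,
   here and in r_odd_cycle. *)
definition r_odd :: "'a sgraph \<Rightarrow> 'b sgraph \<Rightarrow> enat" where
  "r_odd G H = Inf {enat r | r. r \<ge> 1 \<and> (\<exists>\<chi>. odd_ramsey_coloring G H r \<chi>)}"

(* Vertices are taken to be natural numbers: every finite graph is isomorphic to such a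
   graph, and r_odd is invariant under isomorphism. *)
definition r_odd_cycle :: "nat \<Rightarrow> int \<Rightarrow> enat" where
  "r_odd_cycle n d = Inf {r_odd G (cycle_graph n) | G :: nat sgraph.
     simple_graph G \<and> card (verts G) = n \<and> int (min_degree G) \<ge> d}"

end

theory Submission
  imports Defs
begin

text \<open>With two colours it suffices to find a Hamilton cycle with an even number of edges of colour 1.
  Suppose that all Hamilton cycles are odd. A graph on \<open>m\<close> vertices with minimum degree at least
  \<open>(m + 1) / 2\<close> is Hamilton-connected, and the degree condition survives the deletion of a few
  vertices; so whenever these can be inserted between the ends of a Hamilton path of the rest in
  two ways, the two insertions have equal parity. This shows in turn that all 4-cycles are even,
  that all triangles have the same parity \<open>\<tau>\<close>, and that all 5-cycles have parity \<open>\<tau>\<close>.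
  Any two vertices have a common neighbour, so closed walks of length at most 5 control all others:
  after adding \<open>\<tau>\<close> to every edge the colouring is a cut, and a Hamilton cycle, being of even length,
  is even.\<close>

section \<open>Weights along walks\<close>

fun walk_weight :: "('a \<Rightarrow> 'a \<Rightarrow> nat) \<Rightarrow> 'a list \<Rightarrow> nat" where
  "walk_weight f (x # y # zs) = f x y + walk_weight f (y # zs)"
| "walk_weight f _ = 0"

lemma walk_weight_append:
  "walk_weight f (xs @ x # ys) = walk_weight f (xs @ [x]) + walk_weight f (x # ys)"
proof (induction xs)
  case (Cons a xs)
  then show ?case by (cases xs) auto
qed simp

lemma walk_weight_append2:
  assumes "xs \<noteq> []" "ys \<noteq> []"
  shows "walk_weight f (xs @ ys) = walk_weight f xs + f (last xs) (hd ys) + walk_weight f ys"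
proof -
  obtain zs x where xs: "xs = zs @ [x]" using assms(1) by (metis rev_exhaust)
  obtain y us where ys: "ys = y # us" using assms(2) by (metis list.exhaust)
  show ?thesis using walk_weight_append[of f zs x "y # us"] by (simp add: xs ys)
qed

lemma walk_weight_rev:
  assumes "\<And>x y. f x y = f y x"
  shows "walk_weight f (rev xs) = walk_weight f xs"
proof (induction xs)
  case (Cons a xs)
  show ?case
  proof (cases "xs = []")
    case False
    have "walk_weight f (a # xs) = f a (hd xs) + walk_weight f xs"
      using False by (cases xs) auto
    moreover have "walk_weight f (rev xs @ [a]) = walk_weight f (rev xs) + f (hd xs) a"
      using False walk_weight_append2[of "rev xs" "[a]" f] by (simp add: last_rev)
    ultimately show ?thesis using Cons assms by simp
  qed simp
qed simp

lemma walk_weight_conv_sum: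
  "walk_weight f xs = (\<Sum>i<length xs - 1. f (xs ! i) (xs ! Suc i))"
proof (induction f xs rule: walk_weight.induct)
  case (1 f x y zs)
  then show ?case by (simp add: sum.lessThan_Suc_shift del: sum.lessThan_Suc)
qed auto

text \<open>Cutting after positions \<open>k\<close> and \<open>l\<close> and reversing the middle
  piece preserves the weight inside each of the three pieces, by symmetry of \<open>f\<close>; only
  the two pairs at the cuts are replaced. This is the exchange step behind
  \<open>hamilton_connected\<close>.\<close>

lemma walk_weight_reverse_segment:
  assumes sym: "\<And>x y. f x y = f y x" and "k < l" "Suc l < length xs"
  obtains ys where "distinct ys = distinct xs" "set ys = set xs" "hd ys = hd xs" "last ys = last xs"
    "walk_weight f ys + f (xs ! k) (xs ! Suc k) + f (xs ! l) (xs ! Suc l)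
      = walk_weight f xs + f (xs ! k) (xs ! l) + f (xs ! Suc k) (xs ! Suc l)"
proof -
  define A B D where "A = take (Suc k) xs" "B = drop (Suc k) (take (Suc l) xs)" "D = drop (Suc l) xs"
  note ABD = A_B_D_def
  have xs: "xs = A @ B @ D"
  proof -
    have "A @ B = take (Suc l) xs" unfolding ABD using assms(2)
      by (metis append_take_drop_id less_imp_le Suc_le_mono min.absorb1 take_take)
    then show ?thesis unfolding ABD by (metis append.assoc append_take_drop_id)
  qed
  have ne: "A \<noteq> []" "B \<noteq> []" "D \<noteq> []" using assms by (auto simp: ABD)
  have ends: "last A = xs ! k" "hd B = xs ! Suc k" "last B = xs ! l" "hd D = xs ! Suc l"
    using assms ne by (auto simp: last_conv_nth hd_conv_nth) (auto simp: ABD)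
  have W: "walk_weight f (A @ C @ D) = walk_weight f A + f (last A) (hd C) + walk_weight f C
      + f (last C) (hd D) + walk_weight f D" if "C \<noteq> []" for C
    using ne that by (simp add: walk_weight_append2)
  show ?thesis
  proof (rule that[of "A @ rev B @ D"])
    show "hd (A @ rev B @ D) = hd xs" "last (A @ rev B @ D) = last xs" using ne by (auto simp: xs)
    show "distinct (A @ rev B @ D) = distinct xs" "set (A @ rev B @ D) = set xs"
      unfolding xs by auto
    have "walk_weight f xs = walk_weight f A + f (last A) (hd B) + walk_weight f B
      + f (last B) (hd D) + walk_weight f D" using W[of B] ne xs by simp
    then show "walk_weight f (A @ rev B @ D) + f (xs ! k) (xs ! Suc k) + f (xs ! l) (xs ! Suc l)
      = walk_weight f xs + f (xs ! k) (xs ! l) + f (xs ! Suc k) (xs ! Suc l)"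
      using W[of "rev B"] ne by (simp add: hd_rev last_rev walk_weight_rev[OF sym] ends)
  qed
qed

section \<open>Hamilton-connectedness from a degree condition\<close>

lemma card_neighbours_nth:
  assumes "distinct xs"
  shows "card {u \<in> set xs. P u} = card {j. j < length xs \<and> P (xs ! j)}"
proof -
  have "{u \<in> set xs. P u} = (\<lambda>j. xs ! j) ` {j. j < length xs \<and> P (xs ! j)}"
    by (auto simp: in_set_conv_nth)
  moreover have "inj_on (\<lambda>j. xs ! j) {j. j < length xs \<and> P (xs ! j)}"
    using assms by (auto simp: inj_on_def nth_eq_iff_index_eq)
  ultimately show ?thesis by (simp add: card_image)
qed

text \<open>Among all orderings of the vertices from \<open>s\<close> to \<open>t\<close>, one with the fewest non-adjacent
  consecutive pairs has none: by counting, such a pair can be removed by reversing a segment.\<close>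

lemma hamilton_connected:
  assumes fin: "finite U" and sym: "\<And>x y. E x y \<Longrightarrow> E y x" and irr: "\<And>x. \<not> E x x"
    and deg: "\<And>v. v \<in> U \<Longrightarrow> card U + 1 \<le> 2 * card {u \<in> U. E v u}"
    and st: "s \<in> U" "t \<in> U" "s \<noteq> t"
  shows "\<exists>xs. distinct xs \<and> set xs = U \<and> hd xs = s \<and> last xs = t \<and> successively E xs"
proof -
  define f where "f x y = (of_bool (\<not> E x y) :: nat)" for x y
  have fsym: "f x y = f y x" for x y using sym by (auto simp: f_def)
  define Q where "Q xs \<longleftrightarrow> distinct xs \<and> set xs = U \<and> hd xs = s \<and> last xs = t" for xs
  obtain ys where "set ys = U - {s, t}" "distinct ys" using finite_distinct_list fin by blast
  then have "Q (s # ys @ [t])" using st by (auto simp: Q_def)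
  then obtain xs where Q: "Q xs" and least: "\<And>ys. Q ys \<Longrightarrow> walk_weight f xs \<le> walk_weight f ys"
    using ex_has_least_nat[of Q _ "walk_weight f"] by blast
  have xs: "distinct xs" "set xs = U" "hd xs = s" "last xs = t" using Q by (auto simp: Q_def)
  have len: "length xs = card U" using xs distinct_card by fastforce
  have "E (xs ! i) (xs ! Suc i)" if i: "Suc i < length xs" for i
  proof (rule ccontr)
    assume bad: "\<not> E (xs ! i) (xs ! Suc i)"
    define u v where "u = xs ! i" "v = xs ! Suc i"
    note uv = u_v_def
    \<comment> \<open>An index \<open>j\<close> in both sets marks a second cut: reversing between
      the cuts creates the pairs \<open>u\<close>, \<open>xs ! j\<close> and \<open>v\<close>,
      \<open>xs ! Suc j\<close>, both adjacent.\<close>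
    define J1 J2 where "J1 = {j. Suc j < length xs \<and> E u (xs ! j)}"
      "J2 = {j. Suc j < length xs \<and> E v (xs ! Suc j)}"
    note J = J1_J2_def
    have UU: "u \<in> U" "v \<in> U" using i xs(2) by (auto simp: uv)
    have finJ: "finite J1" "finite J2"
      by (auto simp: J intro: finite_subset[of _ "{..<length xs}"])
    have "card {j. j < length xs \<and> E u (xs ! j)} \<le> card (insert (length xs - 1) J1)"
      using finJ by (intro card_mono) (auto simp: J)
    then have c1: "card {x \<in> U. E u x} \<le> card J1 + 1"
      using finJ card_neighbours_nth[OF xs(1), of "E u"] xs(2)
      by (simp add: card_insert_if split: if_splits)
    have "j \<in> insert 0 (Suc ` J2)" if "j < length xs" "E v (xs ! j)" for j
      using that by (cases j) (auto simp: J)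
    then have "card {j. j < length xs \<and> E v (xs ! j)} \<le> card (insert 0 (Suc ` J2))"
      using finJ by (intro card_mono) auto
    then have c2: "card {x \<in> U. E v x} \<le> card J2 + 1"
      using finJ card_neighbours_nth[OF xs(1), of "E v"] xs(2)
      by (simp add: card_insert_if card_image split: if_splits)
    \<comment> \<open>Irreflexivity excludes \<open>i\<close> from both sets, since
      \<open>xs ! i\<close> is \<open>u\<close> and \<open>xs ! Suc i\<close> is \<open>v\<close>.
      So the union has at most \<open>card U - 2\<close> elements, while the two sizes add up to at
      least \<open>card U - 1\<close>.\<close>
    have "J1 \<union> J2 \<subseteq> {..<length xs - 1} - {i}"
      using irr by (auto simp: J uv)
    then have "card (J1 \<union> J2) \<le> card ({..<length xs - 1} - {i})" by (intro card_mono) auto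
    then have c3: "card (J1 \<union> J2) \<le> length xs - 2" using i by simp
    have "card J1 + card J2 = card (J1 \<union> J2) + card (J1 \<inter> J2)"
      using finJ by (rule card_Un_Int)
    then have "card (J1 \<inter> J2) \<noteq> 0" using c1 c2 c3 deg[OF UU(1)] deg[OF UU(2)] i len by linarith
    then have "J1 \<inter> J2 \<noteq> {}" by auto
    then obtain j where "j \<in> J1" "j \<in> J2" by blast
    then have j: "Suc j < length xs" "E (xs ! i) (xs ! j)" "E (xs ! Suc i) (xs ! Suc j)"
      by (auto simp: J uv)
    \<comment> \<open>The second cut may lie on either side of the bad pair.\<close>
    define k l where "k = min i j" "l = max i j"
    have "i \<noteq> j" using j irr by metis
    then have kl: "k < l" "Suc l < length xs" using i j by (auto simp: k_l_def)
    have E': "E (xs ! k) (xs ! l)" "E (xs ! Suc k) (xs ! Suc l)"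
      using j sym by (auto simp: k_l_def min_def max_def)
    have "k = i \<or> l = i" by (auto simp: k_l_def)
    then have bad': "f (xs ! k) (xs ! Suc k) + f (xs ! l) (xs ! Suc l) \<ge> 1"
      using bad by (auto simp: f_def)
    obtain ys where ys: "distinct ys = distinct xs" "set ys = set xs" "hd ys = hd xs" "last ys = last xs"
      "walk_weight f ys + f (xs ! k) (xs ! Suc k) + f (xs ! l) (xs ! Suc l)
        = walk_weight f xs + f (xs ! k) (xs ! l) + f (xs ! Suc k) (xs ! Suc l)"
      by (rule walk_weight_reverse_segment[where f = f, OF fsym kl])
    have "Q ys" using ys xs by (simp add: Q_def)
    moreover have "walk_weight f ys < walk_weight f xs" using ys(5) bad' E' by (simp add: f_def)
    ultimately show False using least by (meson leD)
  qed
  then have "successively E xs" by (auto simp: successively_conv_nth)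
  then show ?thesis using xs by blast
qed

text \<open>The assumption \<open>no_even\<close> is contradictory; the locale collects its consequences.\<close>

locale odd_hamilton_graph =
  fixes V :: "'a set" and E :: "'a \<Rightarrow> 'a \<Rightarrow> bool" and w :: "'a \<Rightarrow> 'a \<Rightarrow> nat"
  assumes fin: "finite V" and ne: "V \<noteq> {}" and even_card: "even (card V)"
    and E_V: "\<And>x y. E x y \<Longrightarrow> x \<in> V"
    and E_sym: "\<And>x y. E x y \<Longrightarrow> E y x" and E_irr: "\<And>x. \<not> E x x"
    and w_sym: "\<And>x y. w x y = w y x"
    and deg: "\<And>v. v \<in> V \<Longrightarrow> card V + 4 \<le> 2 * card {u. E v u}"
    and no_even: "\<And>xs. distinct xs \<Longrightarrow> set xs = V \<Longrightarrow> successively E (xs @ [hd xs]) \<Longrightarrow>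
      odd (walk_weight w (xs @ [hd xs]))"
begin

section \<open>Common neighbours and rerouting of Hamilton cycles\<close>

lemma E_V2: "E x y \<Longrightarrow> y \<in> V"
  using E_V E_sym by blast

lemma E_neq: "E x y \<Longrightarrow> x \<noteq> y"
  using E_irr by blast

text \<open>Two neighbourhoods inside \<open>V\<close> have total size at least
  \<open>card V + 4\<close>, hence share at least four vertices, and three can be avoided.\<close>

lemma common_neighbour:
  assumes "x \<in> V" "y \<in> V" "card F \<le> 3" "finite F"
  obtains u where "E x u" "E y u" "u \<notin> F"
proof -
  have s: "{u. E x u} \<subseteq> V" "{u. E y u} \<subseteq> V" using E_V2 by auto
  then have f: "finite {u. E x u}" "finite {u. E y u}" using fin finite_subset by auto
  have "card ({u. E x u} \<union> {u. E y u}) \<le> card V" using s fin by (intro card_mono) auto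
  then have "card ({u. E x u} \<inter> {u. E y u}) \<ge> 4"
    using card_Un_Int[OF f] deg[OF assms(1)] deg[OF assms(2)] by linarith
  then have "\<not> {u. E x u} \<inter> {u. E y u} \<subseteq> F"
    using assms(3) card_mono[OF assms(4), of "{u. E x u} \<inter> {u. E y u}"] by linarith
  then show ?thesis using that by blast
qed

text \<open>The slack in \<open>deg\<close> pays for deleting \<open>S\<close>: twice the degree of
  \<open>v\<close> inside \<open>V - S\<close> is at least \<open>card V + 4 - (card S + 3)\<close>,
  which is the bound \<open>card (V - S) + 1\<close> required by
  \<open>hamilton_connected\<close>.\<close>

lemma hamilton_path_avoiding:
  assumes S: "S \<subseteq> V" and st: "s \<in> V - S" "t \<in> V - S" "s \<noteq> t"
    and few: "\<And>v. v \<in> V - S \<Longrightarrow> 2 * card {u \<in> S. E v u} \<le> card S + 3"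
  obtains P where "distinct P" "set P = V - S" "hd P = s" "last P = t" "successively E P"
proof -
  have finS: "finite S" using S fin finite_subset by blast
  have dg: "card (V - S) + 1 \<le> 2 * card {u \<in> V - S. E v u}" if v: "v \<in> V - S" for v
  proof -
    have "card {u. E v u} = card ({u \<in> V - S. E v u} \<union> {u \<in> S. E v u})"
      using E_V2 by (intro arg_cong[of _ _ card]) blast
    moreover have "card ({u \<in> V - S. E v u} \<union> {u \<in> S. E v u})
        = card {u \<in> V - S. E v u} + card {u \<in> S. E v u}"
      using fin finS by (intro card_Un_disjoint) auto
    moreover have "card (V - S) + card S = card V"
      using S fin finS by (simp add: card_Diff_subset card_mono)
    moreover have "v \<in> V" using v by simp
    ultimately show ?thesis using deg[of v] few[OF v] by linarith
  qed
  have "finite (V - S)" using fin by simp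
  then have "\<exists>P. distinct P \<and> set P = V - S \<and> hd P = s \<and> last P = t \<and> successively E P"
  proof (rule hamilton_connected)
  qed (fact E_sym E_irr dg st)+
  then obtain P where "distinct P" "set P = V - S" "hd P = s" "last P = t" "successively E P"
    by (elim exE conjE)
  then show ?thesis by (rule that)
qed

text \<open>A Hamilton path of \<open>V - S\<close> can be closed up both ways, and both cycles are odd.\<close>

lemma reroute:
  assumes st: "s \<in> V - S" "t \<in> V - S" "s \<noteq> t" and S: "S \<subseteq> V"
    and few: "\<And>v. v \<in> V - S \<Longrightarrow> 2 * card {u \<in> S. E v u} \<le> card S + 3"
    and L: "distinct L" "set L = S" "successively E (t # L @ [s])"
    and L': "distinct L'" "set L' = S" "successively E (t # L' @ [s])"
  shows "even (walk_weight w (t # L @ [s]) + walk_weight w (t # L' @ [s]))"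
proof -
  obtain P where P: "distinct P" "set P = V - S" "hd P = s" "last P = t" "successively E P"
    by (rule hamilton_path_avoiding[OF S st few])
  then have "P \<noteq> []" using st by auto
  then obtain Q where Q: "P = Q @ [t]" using P(4) by (metis append_butlast_last_id)
  have "odd (walk_weight w P + walk_weight w (t # K @ [s]))"
    if K: "distinct K" "set K = S" "successively E (t # K @ [s])" for K
  proof -
    have "hd (P @ K) = s" using \<open>P \<noteq> []\<close> P by simp
    moreover have "successively E ((P @ K) @ [s])"
      using K(3) P(5) by (auto simp: Q successively_append_iff successively_Cons)
    moreover have "distinct (P @ K)" "set (P @ K) = V" using K P S by auto
    ultimately have "odd (walk_weight w ((P @ K) @ [s]))" using no_even[of "P @ K"] by simp
    then show ?thesis using walk_weight_append[of w Q t "K @ [s]"] by (simp add: Q)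
  qed
  from this[OF L] this[OF L'] show ?thesis by simp
qed

text \<open>Delete \<open>a\<close>, \<open>c\<close> and a common neighbour \<open>x\<close> of
  them outside the cycle, and reinsert them between \<open>d\<close> and \<open>b\<close> as
  \<open>c, x, a\<close> or as \<open>a, x, c\<close>: the edges at \<open>x\<close> occur twice and
  the 4-cycle remains. For three deleted vertices the condition \<open>few\<close> of
  \<open>reroute\<close> is automatic.\<close>

lemma four_cycle_even:
  assumes "E a b" "E b c" "E c d" "E d a" "a \<noteq> c" "b \<noteq> d"
  shows "even (w a b + w b c + w c d + w d a)"
proof -
  note E = assms(1-4) assms(1-4)[THEN E_sym]
  obtain x where "E a x" "E c x" and x: "x \<notin> {b, d}"
    by (rule common_neighbour[of a c "{b, d}"]) (auto simp: card_insert_if intro: E[THEN E_V])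
  note E = E this(1,2) this(1,2)[THEN E_sym]
  have "2 * card {u \<in> {a, x, c}. E v u} \<le> card {a, x, c} + 3" for v
  proof -
    have "card {u \<in> {a, x, c}. E v u} \<le> card {a, x, c}" by (intro card_mono) auto
    moreover have "card {a, x, c} = 3" using assms E[THEN E_neq] by auto
    ultimately show ?thesis by simp
  qed
  then have "even (walk_weight w (d # [c, x, a] @ [b]) + walk_weight w (d # [a, x, c] @ [b]))"
    using assms(5,6) x E E[THEN E_neq] E[THEN E_V] by (intro reroute[of _ "{a, x, c}"]) auto
  moreover have "walk_weight w (d # [c, x, a] @ [b]) + walk_weight w (d # [a, x, c] @ [b])
      = w a b + w b c + w c d + w d a + 2 * (w a x + w x c)"
    using w_sym[of x c] w_sym[of x a] w_sym[of d c] w_sym[of c b] by simp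
  ultimately show ?thesis by (metis dvd_add_left_iff dvd_triv_left)
qed

section \<open>Parity of triangles\<close>

abbreviation tri :: "'a \<Rightarrow> 'a \<Rightarrow> 'a \<Rightarrow> nat" where
  "tri x y u \<equiv> w x y + w y u + w u x"

lemma apex:
  assumes "E x y"
  obtains u where "E x u" "E y u"
  using common_neighbour[of x y "{}"] E_V E_V2 assms by auto

text \<open>Modulo 2 the shared edge cancels, which leaves the 4-cycle
  \<open>x u y v\<close>.\<close>

lemma triangles_on_edge:
  assumes "E x y" "E x u" "E y u" "E x v" "E y v"
  shows "even (tri x y u + tri x y v)"
proof (cases "u = v")
  case False
  have "even (w x u + w u y + w y v + w v x)"
    using assms assms[THEN E_neq] assms[THEN E_sym] False by (intro four_cycle_even)
  then show ?thesis by (auto simp: w_sym)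
qed simp

text \<open>If the two triangles differed in parity, no vertex would be adjacent to all four of
  \<open>z\<close>, \<open>p\<close>, \<open>y\<close>, \<open>q\<close>; so these four can be deleted and reinserted between \<open>c\<close> and \<open>a\<close> in two ways.\<close>

lemma triangles_on_opposite_edges:
  assumes zp: "E z p" and py: "E p y" and yq: "E y q" and qz: "E q z"
    and ne: "z \<noteq> y" "p \<noteq> q"
    and a: "E z a" "E p a" and c: "E y c" "E q c"
  shows "even (tri z p a + tri y q c)"
proof (rule ccontr)
  assume odd: "\<not> even (tri z p a + tri y q c)"
  note E = zp py yq qz a c zp[THEN E_sym] py[THEN E_sym] yq[THEN E_sym] qz[THEN E_sym]
    a[THEN E_sym] c[THEN E_sym]
  \<comment> \<open>Modulo 2 the triangles \<open>v z p\<close> and \<open>v y q\<close> add up to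
    the 4-cycles \<open>z p v q\<close> and \<open>v z q y\<close>, whose common edge
    \<open>q z\<close> cancels.\<close>
  have not4: "\<not> (E v z \<and> E v p \<and> E v y \<and> E v q)" for v
  proof
    assume v: "E v z \<and> E v p \<and> E v y \<and> E v q"
    then have v': "E z v" "E p v" "E y v" "E q v" using E_sym by blast+
    have "even (tri z p a + tri z p v)" "even (tri y q c + tri y q v)"
      by (intro triangles_on_edge E v')+
    moreover have "even (w z p + w p v + w v q + w q z)"
      by (rule four_cycle_even) (use v v' E v'[THEN E_neq] ne in auto)
    moreover have "even (w v z + w z q + w q y + w y v)"
      by (rule four_cycle_even) (use v v' E v'[THEN E_neq] ne in auto)
    ultimately show False using odd by (auto simp: w_sym)
  qed
  have "a \<noteq> c" using not4[of a] E by auto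
  \<comment> \<open>The ends of the inserted path must lie off the 4-cycle. If \<open>a\<close> or
    \<open>c\<close> lay on it, a diagonal would be an edge, and comparing triangles along shared
    edges would give equal parities.\<close>
  moreover have "a \<noteq> y"
  proof
    assume "a = y"
    note E' = E[unfolded this]
    have "even (tri z y p + tri z y q)" "even (tri y q c + tri y q z)"
      by (intro triangles_on_edge E E')+
    with odd \<open>a = y\<close> show False by (auto simp: w_sym)
  qed
  moreover have "a \<noteq> q"
  proof
    assume "a = q"
    note E' = E[unfolded this]
    have "even (tri p q z + tri p q y)" "even (tri y q c + tri y q p)"
      by (intro triangles_on_edge E E')+
    with odd \<open>a = q\<close> show False by (auto simp: w_sym)
  qed
  moreover have "c \<noteq> z"
  proof
    assume "c = z"
    note E' = E[unfolded this]
    have "even (tri z y p + tri z y q)" "even (tri z p a + tri z p y)"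
      by (intro triangles_on_edge E E')+
    with odd \<open>c = z\<close> show False by (auto simp: w_sym)
  qed
  moreover have "c \<noteq> p"
  proof
    assume "c = p"
    note E' = E[unfolded this]
    have "even (tri p q z + tri p q y)" "even (tri z p a + tri z p q)"
      by (intro triangles_on_edge E E')+
    with odd \<open>c = p\<close> show False by (auto simp: w_sym)
  qed
  moreover have few: "2 * card {u \<in> {z, p, y, q}. E v u} \<le> card {z, p, y, q} + 3" for v
  proof -
    have card: "card {z, p, y, q} = 4" using ne E[THEN E_neq] by auto
    obtain m where "m \<in> {z, p, y, q}" "\<not> E v m" using not4[of v] by blast
    then have "card {u \<in> {z, p, y, q}. E v u} \<le> card ({z, p, y, q} - {m})"
      by (intro card_mono) auto
    also have "\<dots> = 3" using card \<open>m \<in> {z, p, y, q}\<close> by (subst card_Diff_singleton) auto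
    finally show ?thesis using card by simp
  qed
  \<comment> \<open>Modulo 2 the insertions differ by \<open>c q\<close>, \<open>c y\<close>,
    \<open>z a\<close>, \<open>p a\<close>, \<open>p y\<close> and \<open>q z\<close>; adding the
    4-cycle trades the last two for \<open>z p\<close> and \<open>y q\<close>, which completes the
    two triangles.\<close>
  ultimately have "even (walk_weight w (c # [q, y, p, z] @ [a]) + walk_weight w (c # [y, q, z, p] @ [a]))"
    using ne E E[THEN E_neq] E[THEN E_V] by (intro reroute[of _ "{z, p, y, q}"]) auto
  moreover have "even (w z p + w p y + w y q + w q z)"
    using zp py yq qz ne by (rule four_cycle_even)
  ultimately show False using odd by (auto simp: w_sym)
qed

text \<open>For distinct \<open>a\<close> and \<open>c\<close>, the edges \<open>x a\<close> and
  \<open>x c\<close> are opposite to the same edge \<open>y b\<close> in the 4-cycles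
  \<open>x a y b\<close> and \<open>x c y b\<close>, so both triangles are compared with one on
  \<open>y b\<close>.\<close>

lemma triangles_at_vertex:
  assumes "E x a" "E x a'" "E a a'" "E x c" "E x c'" "E c c'"
  shows "even (tri x a a' + tri x c c')"
proof (cases "a = c")
  case True
  note E = assms[unfolded True]
  show ?thesis unfolding True by (intro triangles_on_edge E)
next
  case False
  obtain y where y: "E a y" "E c y" "y \<notin> {x}"
    by (rule common_neighbour[of a c "{x}"]) (use assms[THEN E_V] assms[THEN E_V2] in auto)
  obtain b where b: "E x b" "E y b" "b \<notin> {a, c}"
    by (rule common_neighbour[of x y "{a, c}"])
      (use assms[THEN E_V] y(1)[THEN E_V2] in \<open>auto simp: card_insert_if\<close>)
  obtain d where d: "E y d" "E b d" using apex[OF b(2)] by blast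
  have ne: "x \<noteq> y" "a \<noteq> b" "c \<noteq> b" using y(3) b(3) by auto
  have "even (tri x a a' + tri y b d)" "even (tri x c c' + tri y b d)"
    by (intro triangles_on_opposite_edges assms y(1,2) y(1,2)[THEN E_sym] b(1,2) b(1)[THEN E_sym] d ne)+
  then show ?thesis by auto
qed

text \<open>A common neighbour \<open>v\<close> of \<open>x\<close> and the fixed vertex
  \<open>s\<close> carries the parity from \<open>x\<close> through \<open>v\<close> to
  \<open>s\<close>, using triangles on \<open>x v\<close> and \<open>v s\<close>.\<close>

lemma triangle_parity:
  "\<exists>\<tau>. \<forall>x y u. E x y \<longrightarrow> E y u \<longrightarrow> E u x \<longrightarrow> even (tri x y u + \<tau>)"
proof -
  obtain s where s: "s \<in> V" using ne by blast
  obtain a where a: "E s a" by (rule common_neighbour[of s s "{}"]) (use s in auto)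
  obtain b where b: "E s b" "E a b" using apex[OF a] by blast
  have "even (tri x y u + tri s a b)" if t: "E x y" "E y u" "E u x" for x y u
  proof -
    obtain v where v: "E x v" "E s v"
      by (rule common_neighbour[of x s "{}"]) (use s t[THEN E_V] in auto)
    note v' = v[THEN E_sym]
    obtain r where r: "E x r" "E v r" using apex[OF v(1)] by blast
    obtain r' where r': "E s r'" "E v r'" using apex[OF v(2)] by blast
    have "even (tri x y u + tri x v r)" using t t(3)[THEN E_sym] v r by (intro triangles_at_vertex)
    moreover have "even (tri v x r + tri v s r')" using v' r r' by (intro triangles_at_vertex)
    moreover have "even (tri s v r' + tri s a b)" using v r' a b by (intro triangles_at_vertex)
    ultimately show ?thesis by (auto simp: w_sym)
  qed
  then have *: "\<forall>x y u. E x y \<longrightarrow> E y u \<longrightarrow> E u x \<longrightarrow> even (tri x y u + tri s a b)"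
    by (intro allI impI)
  show ?thesis by (rule exI[of _ "tri s a b"]) (rule *)
qed

section \<open>Parity of 5-cycles and a potential\<close>

context
  fixes \<tau> :: nat
  assumes tri_parity: "\<And>x y u. E x y \<Longrightarrow> E y u \<Longrightarrow> E u x \<Longrightarrow> even (tri x y u + \<tau>)"
begin

abbreviation five :: "'a \<Rightarrow> 'a \<Rightarrow> 'a \<Rightarrow> 'a \<Rightarrow> 'a \<Rightarrow> nat" where
  "five a b c d e \<equiv> w a b + w b c + w c d + w d e + w e a + \<tau>"

text \<open>The chord splits the cycle into a triangle and a 4-cycle.\<close>

lemma five_cycle_chord:
  assumes "E a b" "E b c" "E c d" "E d e" "E e a" "distinct [a, b, c, d, e]" "E a c"
  shows "even (five a b c d e)"
proof -
  have "even (tri a b c + \<tau>)" using assms E_sym by (intro tri_parity)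
  moreover have "even (w a c + w c d + w d e + w e a)"
    by (rule four_cycle_even) (use assms in auto)
  ultimately show ?thesis by (auto simp: w_sym)
qed

text \<open>The three spokes at \<open>v\<close> split the cycle into a triangle and two 4-cycles,
  and each spoke is counted twice.\<close>

lemma five_cycle_outside:
  assumes "E a b" "E b c" "E c d" "E d e" "E e a" "distinct [a, b, c, d, e, v]"
    and "E v a" "E v b" "E v d"
  shows "even (five a b c d e)"
proof -
  note v = assms(7-9)[THEN E_sym]
  have "even (tri v a b + \<tau>)" using assms v by (intro tri_parity)
  moreover have "even (w v b + w b c + w c d + w d v)"
    by (rule four_cycle_even) (use assms v in auto)
  moreover have "even (w v d + w d e + w e a + w a v)"
    by (rule four_cycle_even) (use assms v in auto)
  ultimately show ?thesis by (auto simp: w_sym)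
qed

text \<open>A 5-cycle of the wrong parity has no chords and every other vertex has at most three
  neighbours on it. It is deleted and reinserted between a common neighbour \<open>q\<close> of \<open>c\<close> and \<open>e\<close> and
  a common neighbour \<open>p\<close> of \<open>a\<close> and \<open>b\<close>; the difference is the odd 6-cycle \<open>p a e q c b\<close>.\<close>

lemma five_cycle_even:
  assumes Y: "E a b" "E b c" "E c d" "E d e" "E e a" and dist: "distinct [a, b, c, d, e]"
  shows "even (five a b c d e)"
proof (rule ccontr)
  assume odd: "\<not> even (five a b c d e)"
  \<comment> \<open>The two preceding lemmas treat one chord and one triple; the rotations give all
    five of each.\<close>
  have rot: "five b c d e a = five a b c d e" "five c d e a b = five a b c d e"
    "five d e a b c = five a b c d e" "five e a b c d = five a b c d e"
    by simp_all
  have odds: "\<not> even (five a b c d e)" "\<not> even (five b c d e a)" "\<not> even (five c d e a b)"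
    "\<not> even (five d e a b c)" "\<not> even (five e a b c d)"
    using odd by (simp_all only: rot not_False_eq_True)
  have dists: "distinct [b, c, d, e, a]" "distinct [c, d, e, a, b]"
    "distinct [d, e, a, b, c]" "distinct [e, a, b, c, d]"
    using dist by auto
  note Y' = Y[THEN E_sym]
  have chords: "\<not> E a c" "\<not> E b d" "\<not> E c e" "\<not> E d a" "\<not> E e b"
    using five_cycle_chord odds Y dist dists by blast+
  then have chords': "\<not> E c a" "\<not> E d b" "\<not> E e c" "\<not> E a d" "\<not> E b e"
    using E_sym by blast+
  have outside: "\<not> (E v a \<and> E v b \<and> E v d)" "\<not> (E v b \<and> E v c \<and> E v e)" "\<not> (E v c \<and> E v d \<and> E v a)"
    "\<not> (E v d \<and> E v e \<and> E v b)" "\<not> (E v e \<and> E v a \<and> E v c)" if v: "v \<notin> {a, b, c, d, e}" for v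
  proof -
    have "distinct [a, b, c, d, e, v]" "distinct [b, c, d, e, a, v]" "distinct [c, d, e, a, b, v]"
      "distinct [d, e, a, b, c, v]" "distinct [e, a, b, c, d, v]"
      using dist v by auto
    then show "\<not> (E v a \<and> E v b \<and> E v d)" "\<not> (E v b \<and> E v c \<and> E v e)"
      "\<not> (E v c \<and> E v d \<and> E v a)" "\<not> (E v d \<and> E v e \<and> E v b)" "\<not> (E v e \<and> E v a \<and> E v c)"
      using five_cycle_outside odds Y by blast+
  qed
  have few: "2 * card {u \<in> {a, b, c, d, e}. E v u} \<le> card {a, b, c, d, e} + 3"
    if v: "v \<notin> {a, b, c, d, e}" for v
  proof -
    have card: "card {a, b, c, d, e} = 5" using dist by auto
    \<comment> \<open>Any four vertices of the 5-cycle contain a triple excluded by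
      \<open>outside\<close>.\<close>
    have "\<exists>m\<in>{a, b, c, d, e}. \<exists>m'\<in>{a, b, c, d, e}. m \<noteq> m' \<and> \<not> E v m \<and> \<not> E v m'"
      using outside[OF v] dist by auto
    then obtain m m' where m: "m \<in> {a, b, c, d, e}" "m' \<in> {a, b, c, d, e}" "m \<noteq> m'"
      "\<not> E v m" "\<not> E v m'" by blast
    then have "card {u \<in> {a, b, c, d, e}. E v u} \<le> card ({a, b, c, d, e} - {m, m'})"
      by (intro card_mono) auto
    also have "\<dots> = 3" using card m(1-3) by (subst card_Diff_subset) auto
    finally show ?thesis using card by simp
  qed
  obtain p where p: "E a p" "E b p" using apex[OF Y(1)] by blast
  obtain q where q: "E c q" "E e q" "q \<notin> {d}"
    by (rule common_neighbour[of c e "{d}"]) (use Y[THEN E_V] in auto)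
  note pq = p q(1,2) p[THEN E_sym] q(1,2)[THEN E_sym]
  have p_out: "p \<notin> {a, b, c, d, e}" using p chords chords' E_irr by auto
  have q_out: "q \<notin> {a, b, c, d, e}" using q chords chords' E_irr by auto
  have "p \<noteq> q" using outside(5)[OF p_out] pq by auto
  then have "even (walk_weight w (q # [e, d, c, b, a] @ [p]) + walk_weight w (q # [c, d, e, a, b] @ [p]))"
    (is "even ?W")
    using p_out q_out pq Y Y' few dist Y[THEN E_V] pq[THEN E_V]
    by (intro reroute[of _ "{a, b, c, d, e}"]) auto
  moreover have "even (tri a b p + \<tau>)" using Y pq by (intro tri_parity)
  moreover have "even (w q e + w e d + w d c + w c q)"
    by (rule four_cycle_even) (use pq Y' dist q in auto)
  \<comment> \<open>In the 6-cycle, the triangle replaces \<open>b p a\<close> by \<open>b a\<close>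
    and the 4-cycle replaces \<open>e q c\<close> by \<open>e d c\<close>; the result is the
    5-cycle.\<close>
  ultimately have "even (?W + (tri a b p + \<tau>) + (w q e + w e d + w d c + w c q))"
    by (rule dvd_add[OF dvd_add])
  also have "\<dots> = five a b c d e + 2 * (w q e + w d e + w c d + w a b + w a p + w c q + w b p)"
    by (simp add: w_sym)
  finally show False using odd by (metis dvd_add_left_iff dvd_triv_left)
qed

text \<open>Take for \<open>h\<close> the weight of a walk of length at most 2 from a root
  \<open>z\<close>, with \<open>\<tau>\<close> added per edge. An edge \<open>x y\<close> then
  closes up a walk through \<open>z\<close> of length at most 5, which is a cycle of known parity or
  degenerates to a shorter one.\<close>

lemma potential:
  "\<exists>h :: 'a \<Rightarrow> nat. \<forall>x y. E x y \<longrightarrow> even (w x y + \<tau> + h x + h y)"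
proof -
  obtain z where z: "z \<in> V" using ne by blast
  define c where "c x = (SOME u. E z u \<and> E x u)" for x
  have c: "E z (c x) \<and> E x (c x)" if xV: "x \<in> V" for x
  proof -
    obtain u where "E z u" "E x u"
      by (rule common_neighbour[of z x "{}"]) (use z xV in auto)
    then have "\<exists>u. E z u \<and> E x u" by blast
    then show ?thesis unfolding c_def by (rule someI_ex)
  qed
  \<comment> \<open>The last case carries no \<open>\<tau>\<close> because its two edges would
    contribute it twice.\<close>
  define h where "h x = (if x = z then 0 else if E z x then w z x + \<tau> else w z (c x) + w (c x) x)" for x
  have one: "even (w x y + \<tau> + h x + h y)" if xy: "E x y" and zx: "x = z \<or> E z x" for x y
  proof -
    have yV: "y \<in> V" using xy E_V2 by blast
    consider "x = z" | "y = z" "E z x" | "x \<noteq> z" "y \<noteq> z" "E z x" "E z y"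
      | "x \<noteq> z" "y \<noteq> z" "E z x" "\<not> E z y"
      using zx by blast
    then show ?thesis
    proof cases
      case 1
      then show ?thesis using xy E_irr by (auto simp: h_def)
    next
      case 2
      then show ?thesis using xy E_irr by (auto simp: h_def w_sym)
    next
      case 3
      have "even (tri z x y + \<tau>)" using 3 xy E_sym by (intro tri_parity)
      then show ?thesis using 3 by (auto simp: h_def w_sym)
    next
      case 4
      have "even (w z x + w x y + w y (c y) + w (c y) z)"
      proof (cases "c y = x")
        case False
        then show ?thesis
          by (intro four_cycle_even) (use 4 xy c[OF yV] E_sym in blast)+
      qed (auto simp: w_sym)
      then show ?thesis using 4 by (auto simp: h_def w_sym)
    qed
  qed
  have "even (w x y + \<tau> + h x + h y)" if xy: "E x y" for x y
  proof -
    have yx: "E y x" and V: "x \<in> V" "y \<in> V" using xy E_sym E_V E_V2 by blast+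
    consider "x = z \<or> E z x" | "y = z \<or> E z y" | "x \<noteq> z" "y \<noteq> z" "\<not> E z x" "\<not> E z y" by blast
    then show ?thesis
    proof cases
      case 1
      then show ?thesis using one xy by blast
    next
      case 2
      then show ?thesis using one[OF yx] by (auto simp: w_sym)
    next
      case 3
      have cx: "E z (c x)" "E x (c x)" and cy: "E z (c y)" "E y (c y)" using c V by blast+
      note sym = cx[THEN E_sym] cy[THEN E_sym]
      have "even (w z (c x) + w (c x) x + w x y + w y (c y) + w (c y) z + \<tau>)"
      \<comment> \<open>If the two middle vertices coincide, the closed walk is a triangle together
        with an edge traversed twice.\<close>
      proof (cases "c x = c y")
        case True
        have "even (tri x y (c y) + \<tau>)" using True xy cx cy sym by (intro tri_parity) auto
        then show ?thesis using True by (auto simp: w_sym)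
      next
        case False
        then show ?thesis
          using 3 xy cx cy sym cx[THEN E_neq] cy[THEN E_neq] E_neq[OF xy]
          by (intro five_cycle_even) auto
      qed
      then show ?thesis using 3 by (auto simp: h_def w_sym)
    qed
  qed
  then have *: "\<forall>x y. E x y \<longrightarrow> even (w x y + \<tau> + h x + h y)" by (intro allI impI)
  show ?thesis by (rule exI[of _ h]) (rule *)
qed

text \<open>Along a walk the values of \<open>h\<close> telescope to the two ends. On a Hamilton
  cycle the ends coincide and the even length removes \<open>\<tau>\<close>.\<close>

lemma contradiction_of_tri_parity: False
proof (rule exE[OF potential])
  fix h :: "'a \<Rightarrow> nat"
  assume H: "\<forall>x y. E x y \<longrightarrow> even (w x y + \<tau> + h x + h y)"
  have h: "even (w x y + \<tau> + h x + h y)" if "E x y" for x y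
    by (rule H[rule_format, OF that])
  have walk: "even (walk_weight w (x # xs) + length xs * \<tau> + h x + h (last (x # xs)))"
    if "successively E (x # xs)" for x xs
    using that
  proof (induction xs arbitrary: x)
    case (Cons y xs)
    then have "E x y" "successively E (y # xs)" by auto
    then have "even (walk_weight w (y # xs) + length xs * \<tau> + h y + h (last (y # xs)))"
      and "even (w x y + \<tau> + h x + h y)" using Cons.IH h by blast+
    then show ?case by (auto simp del: last.simps simp: last_ConsR)
  qed simp
  obtain z where z: "z \<in> V" using ne by blast
  \<comment> \<open>Since \<open>z\<close> and \<open>t\<close> are adjacent, a Hamilton path
    between them closes up to a Hamilton cycle.\<close>
  obtain t where t: "E z t" by (rule common_neighbour[of z z "{}"]) (use z in auto)
  obtain P where P: "distinct P" "set P = V - {}" "hd P = z" "last P = t" "successively E P"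
    by (rule hamilton_path_avoiding[of "{}" z t]) (use z t E_V2[OF t] E_neq[OF t] in auto)
  then obtain Q where Q: "P = z # Q" using z by (cases P) auto
  have succ: "successively E (P @ [hd P])"
    using P t[THEN E_sym] by (auto simp: successively_append_iff)
  have "length P = card V" using P distinct_card[of P] by simp
  then have "even (length (Q @ [z]))" using even_card Q by simp
  then have "even (walk_weight w (P @ [hd P]))"
    using walk[of z "Q @ [z]"] succ Q by (cases "even (h z)") simp_all
  moreover have "set P = V" using P(2) by simp
  ultimately show False using no_even[OF P(1) _ succ] by blast
qed

end

lemma contradiction: False
proof (rule exE[OF triangle_parity])
  fix \<tau>
  assume \<tau>: "\<forall>x y u. E x y \<longrightarrow> E y u \<longrightarrow> E u x \<longrightarrow> even (tri x y u + \<tau>)"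
  show False by (rule contradiction_of_tri_parity[of \<tau>]) (rule \<tau>[rule_format])
qed

end

lemma even_hamilton_cycle:
  fixes V :: "'a set" and E :: "'a \<Rightarrow> 'a \<Rightarrow> bool" and w :: "'a \<Rightarrow> 'a \<Rightarrow> nat"
  assumes "finite V" "V \<noteq> {}" "even (card V)"
    and "\<And>x y. E x y \<Longrightarrow> x \<in> V" "\<And>x y. E x y \<Longrightarrow> E y x" "\<And>x. \<not> E x x" "\<And>x y. w x y = w y x"
    and "\<And>v. v \<in> V \<Longrightarrow> card V + 4 \<le> 2 * card {u. E v u}"
  shows "\<exists>xs. distinct xs \<and> set xs = V \<and> successively E (xs @ [hd xs]) \<and>
    even (walk_weight w (xs @ [hd xs]))"
proof (rule ccontr)
  assume "\<not> ?thesis"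
  then have no: "odd (walk_weight w (xs @ [hd xs]))"
    if "distinct xs" "set xs = V" "successively E (xs @ [hd xs])" for xs
    using that by blast
  have "odd_hamilton_graph V E w"
    by (rule odd_hamilton_graph.intro) (fact assms no)+
  then show False by (rule odd_hamilton_graph.contradiction)
qed

section \<open>Closed walks as copies of the cycle graph\<close>

definition closed_walk_edges :: "'a list \<Rightarrow> 'a set set" where
  "closed_walk_edges xs = (\<lambda>i. {xs ! i, xs ! ((i + 1) mod length xs)}) ` {..<length xs}"

text \<open>Two distinct indices with the same edge would be cyclic successors of each other, which
  forces length 2.\<close>

lemma inj_on_closed_walk_edges:
  assumes "distinct xs" "length xs \<ge> 3"
  shows "inj_on (\<lambda>i. {xs ! i, xs ! ((i + 1) mod length xs)}) {..<length xs}"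
proof (rule inj_onI)
  fix i j
  assume i: "i \<in> {..<length xs}" and j: "j \<in> {..<length xs}"
    and eq: "{xs ! i, xs ! ((i + 1) mod length xs)} = {xs ! j, xs ! ((j + 1) mod length xs)}"
  let ?s = "\<lambda>i. (i + 1) mod length xs"
  have s: "?s i < length xs" "?s j < length xs" using assms(2) by (auto intro: mod_less_divisor)
  have "i = j \<or> (i = ?s j \<and> ?s i = j)"
    using eq i j s assms(1) by (auto simp: doubleton_eq_iff nth_eq_iff_index_eq)
  moreover have "\<not> (i = ?s j \<and> ?s i = j)"
    using i j assms(2) by (auto simp: mod_Suc split: if_splits)
  ultimately show "i = j" by blast
qed

lemma cyclic_nth:
  assumes "i < length xs"
  shows "(xs @ [hd xs]) ! i = xs ! i" "(xs @ [hd xs]) ! Suc i = xs ! ((i + 1) mod length xs)"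
proof -
  have "xs \<noteq> []" using assms by auto
  then show "(xs @ [hd xs]) ! i = xs ! i" "(xs @ [hd xs]) ! Suc i = xs ! ((i + 1) mod length xs)"
    using assms by (auto simp: nth_append hd_conv_nth mod_Suc)
qed

text \<open>By injectivity, counting edges is counting steps of the walk; this turns colour counts
  into walk weights.\<close>

lemma card_closed_walk_edges:
  assumes "distinct xs" "length xs \<ge> 3"
  shows "card {e \<in> closed_walk_edges xs. P e}
    = walk_weight (\<lambda>x y. of_bool (P {x, y})) (xs @ [hd xs])"
proof -
  let ?e = "\<lambda>i. {xs ! i, xs ! ((i + 1) mod length xs)}"
  have "{e \<in> closed_walk_edges xs. P e} = ?e ` {i \<in> {..<length xs}. P (?e i)}"
    by (auto simp: closed_walk_edges_def)
  then have "card {e \<in> closed_walk_edges xs. P e} = card (?e ` {i \<in> {..<length xs}. P (?e i)})"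
    by (rule arg_cong)
  also have "\<dots> = card {i \<in> {..<length xs}. P (?e i)}"
    by (intro card_image inj_on_subset[OF inj_on_closed_walk_edges[OF assms]]) auto
  also have "\<dots> = (\<Sum>i<length xs. of_bool (P (?e i)))"
    by (simp add: sum.If_cases of_bool_def Int_def)
  also have "\<dots> = walk_weight (\<lambda>x y. of_bool (P {x, y})) (xs @ [hd xs])"
    by (simp add: walk_weight_conv_sum cyclic_nth del: One_nat_def)
  finally show ?thesis .
qed

text \<open>The isomorphism sends a vertex to its position in \<open>xs\<close>.\<close>

lemma closed_walk_copy:
  assumes G: "simple_graph G" and xs: "distinct xs" "set xs \<subseteq> verts G"
    and walk: "successively (\<lambda>x y. {x, y} \<in> edges G) (xs @ [hd xs])"
  shows "\<lparr>verts = set xs, edges = closed_walk_edges xs\<rparr> \<in> copies (cycle_graph (length xs)) G"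
proof -
  let ?e = "\<lambda>i. {xs ! i, xs ! ((i + 1) mod length xs)}"
  let ?K = "\<lparr>verts = set xs, edges = closed_walk_edges xs\<rparr>"
  have eG: "closed_walk_edges xs \<subseteq> edges G"
  proof
    fix e
    assume "e \<in> closed_walk_edges xs"
    then obtain i where i: "i < length xs" "e = ?e i" by (auto simp: closed_walk_edges_def)
    have "{(xs @ [hd xs]) ! i, (xs @ [hd xs]) ! Suc i} \<in> edges G"
      using walk i by (intro successively_nth[where P = "\<lambda>x y. {x, y} \<in> edges G"]) auto
    then show "e \<in> edges G" using cyclic_nth[OF i(1)] i(2) by simp
  qed
  have mod: "(i + 1) mod length xs < length xs" if "i < length xs" for i
    using that by (intro mod_less_divisor) auto
  have "closed_walk_edges xs \<subseteq> Pow (set xs)"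
    using mod by (auto simp: closed_walk_edges_def)
  then have "subgraph ?K G"
    using eG G xs by (auto simp: subgraph_def simple_graph_def)
  moreover have "isomorphic ?K (cycle_graph (length xs))"
  proof -
    have bij: "bij_betw (\<lambda>i. xs ! i) {0..<length xs} (set xs)"
      using xs by (intro bij_betw_nth) auto
    define f where "f = the_inv_into {0..<length xs} (\<lambda>i. xs ! i)"
    have f: "f (xs ! i) = i" if "i < length xs" for i
      using that bij unfolding f_def bij_betw_def by (intro the_inv_into_f_f) auto
    have fe: "f ` ?e i = {i, (i + 1) mod length xs}" if "i < length xs" for i
      using that mod[OF that] by (simp add: f)
    have "(\<lambda>e. f ` e) ` closed_walk_edges xs = (\<lambda>i. f ` ?e i) ` {..<length xs}"
      by (simp only: closed_walk_edges_def image_image)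
    also have "\<dots> = (\<lambda>i. {i, (i + 1) mod length xs}) ` {..<length xs}"
      by (intro image_cong refl fe) simp
    also have "\<dots> = edges (cycle_graph (length xs))"
      by (auto simp: cycle_graph_def)
    finally have "edges (cycle_graph (length xs)) = (\<lambda>e. f ` e) ` closed_walk_edges xs" by (rule sym)
    moreover have "bij_betw f (set xs) {0..<length xs}"
      unfolding f_def using bij by (rule bij_betw_the_inv_into)
    then have "bij_betw f (set xs) (verts (cycle_graph (length xs)))" by (simp add: cycle_graph_def)
    ultimately show ?thesis unfolding isomorphic_def by auto
  qed
  ultimately show ?thesis by (simp add: copies_def)
qed

section \<open>Two colours do not suffice\<close>

lemma degree_conv_neighbours:
  assumes "simple_graph G"
  shows "degree G v = card {u. {v, u} \<in> edges G}"
proof -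
  have "{e \<in> edges G. v \<in> e} = (\<lambda>u. {v, u}) ` {u. {v, u} \<in> edges G}"
  proof (intro equalityI subsetI)
    fix e
    assume e: "e \<in> {e \<in> edges G. v \<in> e}"
    then have "card e = 2" using assms by (auto simp: simple_graph_def)
    then obtain a b where "e = {a, b}" by (auto simp: card_2_iff)
    with e show "e \<in> (\<lambda>u. {v, u}) ` {u. {v, u} \<in> edges G}" by (auto simp: insert_commute)
  qed auto
  moreover have "inj_on (\<lambda>u. {v, u}) {u. {v, u} \<in> edges G}"
    by (auto simp: inj_on_def doubleton_eq_iff)
  ultimately show ?thesis by (simp add: degree_def card_image)
qed

text \<open>With the indicator of colour 1 as weight, some Hamilton cycle has evenly many edges of
  colour 1. As \<open>n\<close> is even, the remaining edges, all of colour 2, are also even in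
  number.\<close>

lemma two_colours_insufficient:
  fixes G :: "'a sgraph"
  assumes n: "n \<ge> 4" "even n" and G: "simple_graph G" "card (verts G) = n"
    and deg: "min_degree G \<ge> n div 2 + 2" and r: "1 \<le> r" "r < 3"
  shows "\<not> odd_ramsey_coloring G (cycle_graph n) r \<chi>"
proof
  assume odd: "odd_ramsey_coloring G (cycle_graph n) r \<chi>"
  let ?E = "\<lambda>x y. {x, y} \<in> edges G"
  let ?w = "\<lambda>x y. of_bool (\<chi> {x, y} = 1) :: nat"
  have fin: "finite (verts G)" and ne: "verts G \<noteq> {}" using G n by (auto simp: simple_graph_def)
  have "card (verts G) + 4 \<le> 2 * card {u. ?E v u}" if "v \<in> verts G" for v
  proof -
    have "min_degree G \<le> degree G v" unfolding min_degree_def using fin that by simp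
    then have "n div 2 + 2 \<le> card {u. ?E v u}"
      using deg degree_conv_neighbours[OF G(1), of v] by simp
    then have "2 * (n div 2) + 4 \<le> 2 * card {u. ?E v u}" by simp
    then show ?thesis using n G by simp
  qed
  moreover have "x \<in> verts G" if "?E x y" for x y
    using G(1) that by (auto simp: simple_graph_def)
  moreover have "\<not> ?E x x" for x
    using G(1) by (auto simp: simple_graph_def)
  moreover have "even (card (verts G))" using G(2) n by simp
  moreover have "?E y x" if "?E x y" for x y using that by (simp add: insert_commute)
  moreover have "?w x y = ?w y x" for x y by (simp add: insert_commute)
  ultimately have "\<exists>xs. distinct xs \<and> set xs = verts G \<and> successively ?E (xs @ [hd xs]) \<and>
      even (walk_weight ?w (xs @ [hd xs]))"
    using fin ne by (intro even_hamilton_cycle)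
  then obtain xs where xs: "distinct xs" "set xs = verts G" "successively ?E (xs @ [hd xs])"
      and even: "even (walk_weight ?w (xs @ [hd xs]))"
    by blast
  let ?K = "\<lparr>verts = set xs, edges = closed_walk_edges xs\<rparr>"
  have len: "length xs = n" using xs G(2) distinct_card by metis
  have K: "?K \<in> copies (cycle_graph n) G"
    using closed_walk_copy[OF G(1) xs(1) _ xs(3)] xs(2) len by simp
  then obtain c where c: "c \<in> {1..r}" "odd (card {e \<in> edges ?K. \<chi> e = c})"
    using odd unfolding odd_ramsey_coloring_def by blast
  have count: "card {e \<in> closed_walk_edges xs. P e}
      = walk_weight (\<lambda>x y. of_bool (P {x, y})) (xs @ [hd xs])" for P
    using card_closed_walk_edges[of xs P] xs(1) len n by simp
  have red: "even (card {e \<in> closed_walk_edges xs. \<chi> e = 1})"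
    using even count[of "\<lambda>e. \<chi> e = 1"] by simp
  have total: "card (closed_walk_edges xs) = n"
    using inj_on_closed_walk_edges[OF xs(1)] len n by (simp add: closed_walk_edges_def card_image)
  show False
  proof (cases "c = 1")
    case True
    then show False using red c by simp
  next
    case False
    then have "c = 2" "r = 2" using c(1) r by auto
    have "\<chi> e \<in> {1..2}" if "e \<in> closed_walk_edges xs" for e
      using that K odd \<open>r = 2\<close>
      by (auto simp: odd_ramsey_coloring_def edge_coloring_def copies_def subgraph_def)
    then have "closed_walk_edges xs
        = {e \<in> closed_walk_edges xs. \<chi> e = 1} \<union> {e \<in> closed_walk_edges xs. \<chi> e = 2}"
      by force
    moreover have "finite (closed_walk_edges xs)" by (simp add: closed_walk_edges_def)
    ultimately have "n = card {e \<in> closed_walk_edges xs. \<chi> e = 1} + card {e \<in> closed_walk_edges xs. \<chi> e = 2}"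
      using total card_Un_disjoint[of "{e \<in> closed_walk_edges xs. \<chi> e = 1}" "{e \<in> closed_walk_edges xs. \<chi> e = 2}"]
      by force
    then show False using red n(2) c(2) \<open>c = 2\<close> by simp
  qed
qed

theorem theorem1p4:
  fixes n :: nat
  assumes "n \<ge> 4" and "even n"
  shows "r_odd_cycle n (int (n div 2) + 2) \<ge> 3"
proof -
  have "3 \<le> r_odd G (cycle_graph n)"
    if G: "simple_graph G" "card (verts G) = n" "int (min_degree G) \<ge> int (n div 2) + 2"
    for G :: "nat sgraph"
    unfolding r_odd_def
  proof (rule Inf_greatest)
    fix x
    assume "x \<in> {enat r | r. r \<ge> 1 \<and> (\<exists>\<chi>. odd_ramsey_coloring G (cycle_graph n) r \<chi>)}"
    then obtain r \<chi> where x: "x = enat r" "r \<ge> 1" "odd_ramsey_coloring G (cycle_graph n) r \<chi>"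
      by blast
    then have "r \<ge> 3" using two_colours_insufficient[OF assms G(1,2), of r \<chi>] G(3) by linarith
    then show "3 \<le> x" using x(1) by (simp add: numeral_eq_enat)
  qed
  then show ?thesis unfolding r_odd_cycle_def by (auto intro!: Inf_greatest)
qed

end
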